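(* Let $r$ and $b$ be positive integers and $\alpha=\frac{b}{r}$. If $\frac{1}{3}\leq\alpha\leq 1$, then \[ \mathcal{C}(r,b)\geq\frac{4}{7}\left(\frac{\alpha+2}{\alpha+1}\right)(r+b)-4. \]
   Context: All point sets are in general position (no three collinear). An $(r,b)$-set is a set $S=R\cup B$ of $r$ red points and $b$ blue points in general position. A subset $X\subseteq S$ can be $K_{1,3}$-covered if $X$ can be partitioned into subsets of size $4$, each consisting of one point (the center) of one color and three points of the other color, such that the straight-line segments joining each center to the three other points of its subset are pairwise non-crossing (no two intersect except at a common endpoint). $\mathcal{C}(S)$ is the maximum size of a subset of $S$ that can be $K_{1,3}$-covered, and $\mathcal{C}(r,b)$ is the minimum of $\mathcal{C}(S)$ over all $(r,b)$-sets $S$. *)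

theory Defs
  imports "HOL-Analysis.Analysis" "HOL-Library.Disjoint_Sets"
begin

type_synonym point = "real^2"

definition general_position :: "point set \<Rightarrow> bool" where
  "general_position S \<longleftrightarrow>
     (\<forall>p\<in>S. \<forall>q\<in>S. \<forall>s\<in>S. p \<noteq> q \<and> q \<noteq> s \<and> p \<noteq> s \<longrightarrow> \<not> collinear {p, q, s})"

definition rb_set :: "nat \<Rightarrow> nat \<Rightarrow> point set \<Rightarrow> point set \<Rightarrow> bool" where
  "rb_set r b R B \<longleftrightarrow>
     finite R \<and> finite B \<and> card R = r \<and> card B = b \<and> R \<inter> B = {} \<and> general_position (R \<union> B)"

definition K13_block :: "point set \<Rightarrow> point set \<Rightarrow> point \<Rightarrow> point set \<Rightarrow> bool" where
  "K13_block R B c A \<longleftrightarrow>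
     card A = 4 \<and> c \<in> A \<and>
     (c \<in> R \<and> A - {c} \<subseteq> B \<or> c \<in> B \<and> A - {c} \<subseteq> R)"

definition noncrossing :: "point \<times> point \<Rightarrow> point \<times> point \<Rightarrow> bool" where
  "noncrossing e f \<longleftrightarrow>
     closed_segment (fst e) (snd e) \<inter> closed_segment (fst f) (snd f)
       \<subseteq> {fst e, snd e} \<inter> {fst f, snd f}"

text \<open>
  The function \<open>c\<close> selects the center of each block. An edge is recorded as the pair
  (center, leaf); as blocks are disjoint, distinct pairs are distinct segments.
\<close>

definition star_edges :: "point set set \<Rightarrow> (point set \<Rightarrow> point) \<Rightarrow> (point \<times> point) set" where
  "star_edges P c = {(c A, y) | A y. A \<in> P \<and> y \<in> A - {c A}}"

definition K13_coverable :: "point set \<Rightarrow> point set \<Rightarrow> point set \<Rightarrow> bool" where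
  "K13_coverable R B X \<longleftrightarrow>
     (\<exists>P c. partition_on X P \<and> (\<forall>A\<in>P. K13_block R B (c A) A) \<and>
            pairwise noncrossing (star_edges P c))"

definition C_set :: "point set \<Rightarrow> point set \<Rightarrow> nat" where
  "C_set R B = Max {card X | X. X \<subseteq> R \<union> B \<and> K13_coverable R B X}"

definition C_num :: "nat \<Rightarrow> nat \<Rightarrow> nat" where
  "C_num r b = Min {C_set R B | R B. rb_set r b R B}"

text \<open>The maximum and the minimum above range over finite nonempty sets.\<close>

lemma C_set_finite:
  assumes "finite R" "finite B"
  shows "finite {card X | X. X \<subseteq> R \<union> B \<and> K13_coverable R B X}"
  using assms by simp

lemma C_set_nonempty: "{card X | X. X \<subseteq> R \<union> B \<and> K13_coverable R B X} \<noteq> {}"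
proof -
  have "K13_coverable R B {}"
    unfolding K13_coverable_def star_edges_def
    by (rule exI[of _ "{}"]) (auto simp: partition_on_def disjoint_def)
  then show ?thesis by blast
qed

lemma C_num_finite: "finite {C_set R B | R B. rb_set r b R B}"
proof (rule finite_subset)
  show "{C_set R B | R B. rb_set r b R B} \<subseteq> {..r + b}"
  proof clarsimp
    fix R B assume rb: "rb_set r b R B"
    then have fin: "finite R" "finite B" by (auto simp: rb_set_def)
    have "C_set R B \<in> {card X | X. X \<subseteq> R \<union> B \<and> K13_coverable R B X}"
      unfolding C_set_def by (rule Max_in[OF C_set_finite[OF fin] C_set_nonempty])
    then obtain X where "C_set R B = card X" "X \<subseteq> R \<union> B" by blast
    then have "C_set R B \<le> card (R \<union> B)" using fin by (simp add: card_mono)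
    also have "\<dots> \<le> r + b" using rb card_Un_le[of R B] by (simp add: rb_set_def)
    finally show "C_set R B \<le> r + b" .
  qed
qed simp

lemma C_num_nonempty: "{C_set R B | R B. rb_set r b R B} \<noteq> {}"
proof -
  define f :: "nat \<Rightarrow> point" where "f i = vector [real i, (real i)\<^sup>2]" for i
  have f1: "f i $ 1 = real i" and f2: "f i $ 2 = (real i)\<^sup>2" for i
    by (simp_all add: f_def)
  have inj: "inj f" by (metis f1 injI of_nat_eq_iff)
  have nc: "\<not> collinear {f i, f j, f k}" if d: "i \<noteq> j" "j \<noteq> k" "i \<noteq> k" for i j k
  proof
    assume "collinear {f i, f j, f k}"
    then obtain u s t where s: "f j - f i = s *\<^sub>R u" and t: "f k - f i = t *\<^sub>R u"
      unfolding collinear_def by blast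
    have s': "real j - real i = s * u $ 1" "(real j)\<^sup>2 - (real i)\<^sup>2 = s * u $ 2"
      using arg_cong[OF s, of "\<lambda>v. v $ 1"] arg_cong[OF s, of "\<lambda>v. v $ 2"] by (simp_all add: f1 f2)
    have t': "real k - real i = t * u $ 1" "(real k)\<^sup>2 - (real i)\<^sup>2 = t * u $ 2"
      using arg_cong[OF t, of "\<lambda>v. v $ 1"] arg_cong[OF t, of "\<lambda>v. v $ 2"] by (simp_all add: f1 f2)
    have "(real j - real i) * ((real k)\<^sup>2 - (real i)\<^sup>2) = ((real j)\<^sup>2 - (real i)\<^sup>2) * (real k - real i)"
      unfolding s' t' by simp
    then have "(real j - real i) * (real k - real i) * (real k - real j) = 0"
      by (simp add: algebra_simps power2_eq_square)
    then show False using d by simp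
  qed
  have "rb_set r b (f ` {..<r}) (f ` {r..<r + b})"
    unfolding rb_set_def general_position_def
  proof (intro conjI ballI impI)
    show "card (f ` {..<r}) = r" "card (f ` {r..<r + b}) = b"
      using inj by (simp_all add: card_image inj_on_subset)
    show "f ` {..<r} \<inter> f ` {r..<r + b} = {}" using inj by (auto dest: injD)
  next
    fix p q s assume "p \<in> f ` {..<r} \<union> f ` {r..<r + b}" "q \<in> f ` {..<r} \<union> f ` {r..<r + b}"
      "s \<in> f ` {..<r} \<union> f ` {r..<r + b}" and d: "p \<noteq> q \<and> q \<noteq> s \<and> p \<noteq> s"
    then obtain i j k where "p = f i" "q = f j" "s = f k" by blast
    then show "\<not> collinear {p, q, s}" using d nc by metis
  qed simp_all
  then show ?thesis by blast
qed

end

theory Submission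
  imports Defs
begin

text \<open>
  Since \<open>(\<alpha> + 2) / (\<alpha> + 1) * (r + b) = 2 r + b\<close>, give each red point weight 2 and each blue point
  weight 1: a star with blue center has weight exactly 7, and five points \<open>(2, 3)\<close> of weight 7 contain
  a star with red center. So we look for \<open>k\<close> stars whenever the weight is at least \<open>7 k\<close> and both
  colors have at least \<open>k\<close> points. If one color has \<open>3 k\<close> points, all centers can be taken in the
  other color, and an assignment of the leaves of minimum total length has no crossings. Otherwise
  remove blue points until the weight is \<open>7 k\<close> and split the set by a line into parts of weights
  \<open>7 j\<close> and \<open>7 (k - j)\<close>, where \<open>j = k div 2\<close>, both satisfying the same hypotheses.

  Such a line exists because the set of directions \<open>u \<noteq> 0\<close> is connected. Sweeping in direction \<open>u\<close>
  traces a monotone lattice path of pairs (red points passed, blue points passed). If no path visits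
  \<open>(x, y)\<close>, then by connectedness all paths run above it or all run below it, while replacing \<open>u\<close> by
  \<open>-u\<close> reflects the path in its center. For the pairs \<open>(x, 7 j - 2 x)\<close> this is contradictory.
\<close>

section \<open>Order of two point sets along a rotating direction\<close>

text \<open>In direction \<open>u\<close>, the \<open>x\<close>-th smallest point of \<open>X\<close> lies before the \<open>y\<close>-th largest point of \<open>Y\<close>.\<close>

definition precedes :: "'a::real_inner set \<Rightarrow> nat \<Rightarrow> 'a set \<Rightarrow> nat \<Rightarrow> 'a \<Rightarrow> bool" where
  "precedes X x Y y u \<longleftrightarrow>
     (\<exists>X'\<subseteq>X. \<exists>Y'\<subseteq>Y. card X' = x \<and> card Y' = y \<and> (\<forall>p\<in>X'. \<forall>q\<in>Y'. u \<bullet> p < u \<bullet> q))"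

lemma precedesI:
  assumes "X' \<subseteq> X" "Y' \<subseteq> Y" "x \<le> card X'" "y \<le> card Y'"
    and "\<And>p q. p \<in> X' \<Longrightarrow> q \<in> Y' \<Longrightarrow> u \<bullet> p < u \<bullet> q"
  shows "precedes X x Y y u"
proof -
  obtain X'' where "X'' \<subseteq> X'" "card X'' = x"
    using obtain_subset_with_card_n[OF assms(3)] by metis
  moreover obtain Y'' where "Y'' \<subseteq> Y'" "card Y'' = y"
    using obtain_subset_with_card_n[OF assms(4)] by metis
  ultimately have "X'' \<subseteq> X" "Y'' \<subseteq> Y" "card X'' = x" "card Y'' = y"
    "\<forall>p\<in>X''. \<forall>q\<in>Y''. u \<bullet> p < u \<bullet> q"
    using assms(1,2) by (auto intro: assms(5))
  then show ?thesis unfolding precedes_def by blast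
qed

lemma precedesE:
  assumes "precedes X x Y y u"
  obtains X' Y' where "X' \<subseteq> X" "Y' \<subseteq> Y" "card X' = x" "card Y' = y"
    "\<And>p q. p \<in> X' \<Longrightarrow> q \<in> Y' \<Longrightarrow> u \<bullet> p < u \<bullet> q"
  using assms unfolding precedes_def by blast

lemma precedes_uminus:
  assumes "precedes X x Y y u"
  shows "precedes Y y X x (- u)"
  using assms by (rule precedesE) (rule precedesI, auto)

text \<open>Each inequality is strict, hence open in \<open>u\<close>, and finiteness leaves only
  finite intersections.\<close>

lemma open_precedes:
  assumes "finite X" "finite Y"
  shows "open {u. precedes X x Y y u}"
proof -
  have "{u. precedes X x Y y u} =
      (\<Union>X'\<in>{X'. X' \<subseteq> X \<and> card X' = x}. \<Union>Y'\<in>{Y'. Y' \<subseteq> Y \<and> card Y' = y}.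
         \<Inter>p\<in>X'. \<Inter>q\<in>Y'. {u. u \<bullet> p < u \<bullet> q})"
    unfolding precedes_def by (auto; blast)
  moreover have "open {u. u \<bullet> p < u \<bullet> q}" for p q :: 'a
    by (intro open_Collect_less continuous_intros)
  ultimately show ?thesis
    using assms by (auto intro!: open_UN open_INT simp: finite_subset)
qed

lemma subsets_meet:
  assumes "finite X" "X1 \<subseteq> X" "X2 \<subseteq> X" "card X < card X1 + card X2"
  obtains p where "p \<in> X1" "p \<in> X2"
proof -
  have "X1 \<inter> X2 \<noteq> {}"
  proof
    assume "X1 \<inter> X2 = {}"
    then have "card (X1 \<union> X2) = card X1 + card X2"
      using assms by (meson card_Un_disjoint finite_subset)
    moreover have "card (X1 \<union> X2) \<le> card X"
      using assms by (intro card_mono) auto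
    ultimately show False using assms(4) by linarith
  qed
  then show ?thesis using that by blast
qed

text \<open>By pigeonhole the two subsets of \<open>X\<close> share a point \<open>p\<close> and
  those of \<open>Y\<close> a point \<open>q\<close>, which would then be ordered both ways.\<close>

lemma precedes_clash:
  assumes "finite X" "finite Y" "precedes X x Y y u" "precedes Y y' X x' u"
    and "card X < x + x'" "card Y < y + y'"
  shows False
proof -
  obtain X1 Y1 where 1: "X1 \<subseteq> X" "Y1 \<subseteq> Y" "card X1 = x" "card Y1 = y"
    "\<And>p q. p \<in> X1 \<Longrightarrow> q \<in> Y1 \<Longrightarrow> u \<bullet> p < u \<bullet> q"
    using assms(3) by (metis precedesE)
  obtain Y2 X2 where 2: "Y2 \<subseteq> Y" "X2 \<subseteq> X" "card Y2 = y'" "card X2 = x'"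
    "\<And>p q. p \<in> Y2 \<Longrightarrow> q \<in> X2 \<Longrightarrow> u \<bullet> p < u \<bullet> q"
    using assms(4) by (metis precedesE)
  obtain p where "p \<in> X1" "p \<in> X2"
    using subsets_meet[of X X1 X2] assms 1 2 by auto
  moreover obtain q where "q \<in> Y1" "q \<in> Y2"
    using subsets_meet[of Y Y1 Y2] assms 1 2 by auto
  ultimately show False using 1(5) 2(5) by fastforce
qed

text \<open>The two conditions define disjoint open sets of directions that cover the space without
  the origin, which is connected from dimension 2 on.\<close>

lemma precedes_dichotomy:
  fixes X Y :: "'a::euclidean_space set"
  assumes "2 \<le> DIM('a)" "finite X" "finite Y" "card X < x + x'" "card Y < y + y'"
    and cover: "\<And>u. u \<noteq> 0 \<Longrightarrow> precedes X x Y y u \<or> precedes Y y' X x' u"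
  shows "(\<forall>u. u \<noteq> 0 \<longrightarrow> precedes X x Y y u) \<or> (\<forall>u. u \<noteq> 0 \<longrightarrow> precedes Y y' X x' u)"
proof -
  define U where "U = {u. precedes X x Y y u}"
  define V where "V = {u. precedes Y y' X x' u}"
  have "open U" "open V"
    unfolding U_def V_def using assms by (auto intro: open_precedes)
  moreover have "U \<inter> V = {}"
    unfolding U_def V_def using precedes_clash[OF assms(2,3)] assms(4,5) by blast
  moreover have "- {0} \<subseteq> U \<union> V"
    unfolding U_def V_def using cover by auto
  moreover have "connected (- {0::'a})"
    using assms(1) by (rule connected_punctured_universe)
  ultimately have "U \<inter> - {0} = {} \<or> V \<inter> - {0} = {}"
    unfolding connected_def by blast
  then show ?thesis using cover unfolding U_def V_def by blast
qed

lemma precedes_always_sym: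
  fixes X Y :: "'a::real_inner set"
  assumes "\<forall>u. u \<noteq> 0 \<longrightarrow> precedes X x Y y u"
  shows "\<forall>u. u \<noteq> 0 \<longrightarrow> precedes Y y X x u"
proof (intro allI impI)
  fix u :: 'a assume "u \<noteq> 0"
  then have "precedes X x Y y (- u)" using assms by simp
  then show "precedes Y y X x u" using precedes_uminus by fastforce
qed

text \<open>Used at \<open>- u\<close>, the hypothesis also gives the reverse order at
  \<open>u\<close>; if both subsets were larger than half, the two orders would clash.\<close>

lemma precedes_always_bound:
  fixes X Y :: "'a::euclidean_space set"
  assumes "finite X" "finite Y" "\<forall>u. u \<noteq> 0 \<longrightarrow> precedes X x Y y u"
  shows "2 * x \<le> card X \<or> 2 * y \<le> card Y"
proof (rule ccontr)
  assume "\<not> ?thesis"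
  moreover obtain u :: 'a where "u \<noteq> 0"
    using nonzero_Basis SOME_Basis by blast
  ultimately show False
    using precedes_clash[OF assms(1,2), of x y u y x] assms(3) precedes_always_sym[OF assms(3)] by auto
qed

section \<open>General position and weak separation\<close>

lemma collinear_hyperplane_2:
  fixes u :: point
  assumes "u \<noteq> 0" "\<And>p. p \<in> S \<Longrightarrow> u \<bullet> p = c"
  shows "collinear S"
  unfolding collinear_def
proof (intro exI[of _ "vector [- u $ 2, u $ 1] :: point"] ballI)
  fix p q assume "p \<in> S" "q \<in> S"
  \<comment> \<open>The quarter turn of \<open>u\<close> spans its level lines; the coefficient
    found below is that of the projection of \<open>d\<close> onto \<open>v\<close>.\<close>
  define v :: point where "v = vector [- u $ 2, u $ 1]"
  define d where "d = p - q"
  have v: "v $ 1 = - u $ 2" "v $ 2 = u $ 1" by (simp_all add: v_def)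
  have "u \<bullet> d = 0"
    using assms(2) \<open>p \<in> S\<close> \<open>q \<in> S\<close> by (simp add: d_def inner_diff_right)
  then have d: "u $ 1 * d $ 1 + u $ 2 * d $ 2 = 0"
    by (simp add: inner_vec_def sum_2)
  have n: "(u $ 1)\<^sup>2 + (u $ 2)\<^sup>2 \<noteq> 0"
    using assms(1) by (simp add: vec_eq_iff forall_2 sum_power2_eq_zero_iff)
  have "((u $ 1)\<^sup>2 + (u $ 2)\<^sup>2) * d $ 1 = (u $ 1 * d $ 2 - u $ 2 * d $ 1) * v $ 1"
    "((u $ 1)\<^sup>2 + (u $ 2)\<^sup>2) * d $ 2 = (u $ 1 * d $ 2 - u $ 2 * d $ 1) * v $ 2"
    using d unfolding v by algebra+
  then have "d = ((u $ 1 * d $ 2 - u $ 2 * d $ 1) / ((u $ 1)\<^sup>2 + (u $ 2)\<^sup>2)) *\<^sub>R v"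
    using n by (simp add: vec_eq_iff forall_2 field_simps)
  then show "\<exists>c. p - q = c *\<^sub>R (vector [- u $ 2, u $ 1] :: point)"
    unfolding d_def v_def by blast
qed

lemma general_position_subset:
  "general_position S \<Longrightarrow> T \<subseteq> S \<Longrightarrow> general_position T"
  unfolding general_position_def by blast

lemma general_position_level:
  assumes "general_position S" "u \<noteq> 0" "p \<in> S" "q \<in> S" "s \<in> S" "u \<bullet> p = u \<bullet> q" "u \<bullet> q = u \<bullet> s"
  shows "p = q \<or> q = s \<or> p = s"
proof (rule ccontr)
  assume "\<not> ?thesis"
  moreover have "collinear {p, q, s}"
    using assms by (intro collinear_hyperplane_2[of u _ "u \<bullet> p"]) auto
  ultimately show False using assms unfolding general_position_def by blast
qed

text \<open>A supporting hyperplane cuts the hull in a face, and a face of the hull of a finite set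
  is spanned by some of the given points.\<close>

lemma convex_hull_supporting_hyperplane:
  fixes A :: "'a::euclidean_space set"
  assumes "finite A" "z \<in> convex hull A" "u \<bullet> z = c" "\<And>a. a \<in> A \<Longrightarrow> u \<bullet> a \<le> c"
  shows "z \<in> convex hull {a \<in> A. u \<bullet> a = c}"
proof -
  have "convex hull A \<subseteq> {x. u \<bullet> x \<le> c}"
    using assms(4) by (intro hull_minimal convex_halfspace_le) auto
  then have "(convex hull A \<inter> {x. u \<bullet> x = c}) face_of (convex hull A)"
    by (intro face_of_Int_supporting_hyperplane_le convex_convex_hull) auto
  then obtain A' where A': "A' \<subseteq> A" "convex hull A \<inter> {x. u \<bullet> x = c} = convex hull A'"
    using face_of_convex_hull_subset[OF finite_imp_compact[OF assms(1)]] by metis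
  have "A' \<subseteq> {a \<in> A. u \<bullet> a = c}"
    using A' hull_subset[of A' convex] by blast
  then show ?thesis using A'(2) assms(2,3) hull_mono by blast
qed

text \<open>A common point \<open>z\<close> of the hulls lies on a level line of \<open>u\<close>
  that supports both, hence in the hull of the points of either part on that line. General position
  leaves one point of each part there, and \<open>z\<close> would equal both.\<close>

lemma weakly_separated_hulls_disjoint:
  assumes "finite S" "general_position S" "u \<noteq> 0" "A \<subseteq> S"
    and le: "\<And>a q. a \<in> A \<Longrightarrow> q \<in> S - A \<Longrightarrow> u \<bullet> a \<le> u \<bullet> q"
  shows "convex hull A \<inter> convex hull (S - A) = {}"
proof (rule ccontr)
  assume "\<not> ?thesis"
  then obtain z where z: "z \<in> convex hull A" "z \<in> convex hull (S - A)" by blast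
  define c where "c = u \<bullet> z"
  have fin: "finite A" using assms finite_subset by blast
  have upper: "u \<bullet> z \<le> d" if "\<And>a. a \<in> A \<Longrightarrow> u \<bullet> a \<le> d" for d
    using z(1) hull_minimal[of A "{x. u \<bullet> x \<le> d}" convex] convex_halfspace_le that by blast
  have lower: "u \<bullet> z \<ge> d" if "\<And>q. q \<in> S - A \<Longrightarrow> u \<bullet> q \<ge> d" for d
    using z(2) hull_minimal[of "S - A" "{x. u \<bullet> x \<ge> d}" convex] convex_halfspace_ge that by blast
  have A: "u \<bullet> a \<le> c" if "a \<in> A" for a
    unfolding c_def using that le by (intro lower) auto
  have Q: "u \<bullet> q \<ge> c" if "q \<in> S - A" for q
    unfolding c_def using that le by (intro upper) auto
  have zA: "z \<in> convex hull {a \<in> A. u \<bullet> a = c}"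
    using fin z(1) A by (intro convex_hull_supporting_hyperplane) (auto simp: c_def)
  have zQ: "z \<in> convex hull {q \<in> S - A. (- u) \<bullet> q = - c}"
    using assms(1) z(2) Q by (intro convex_hull_supporting_hyperplane) (auto simp: c_def)
  have "{a \<in> A. u \<bullet> a = c} \<noteq> {}" using zA by (metis convex_hull_empty empty_iff)
  then obtain a where a: "a \<in> A" "u \<bullet> a = c" by blast
  have "{q \<in> S - A. (- u) \<bullet> q = - c} \<noteq> {}" using zQ by (metis convex_hull_empty empty_iff)
  then obtain q where q: "q \<in> S - A" "u \<bullet> q = c" by auto
  have "{a \<in> A. u \<bullet> a = c} \<subseteq> {a}"
    using general_position_level[OF assms(2,3), of _ a q] a q assms(4) by auto
  then have "z = a"
    using zA hull_mono[of _ "{a}" convex]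
    by (metis (no_types, lifting) convex_hull_singleton singletonD subsetD)
  have "{q \<in> S - A. (- u) \<bullet> q = - c} \<subseteq> {q}"
    using general_position_level[OF assms(2,3), of _ q a] a q assms(4) by auto
  then have "z = q"
    using zQ hull_mono[of _ "{q}" convex]
    by (metis (no_types, lifting) convex_hull_singleton singletonD subsetD)
  with \<open>z = a\<close> a q show False by blast
qed

section \<open>Splitting by a line\<close>

text \<open>Separation is encoded by disjoint hulls, not by a direction, since a sweep in direction
  \<open>u\<close> may leave one point of each part on the same level.\<close>

definition splits :: "point set \<Rightarrow> point set \<Rightarrow> nat \<Rightarrow> nat \<Rightarrow> bool" where
  "splits X Y x y \<longleftrightarrow> (\<exists>A\<subseteq>X \<union> Y. card (A \<inter> X) = x \<and> card (A \<inter> Y) = y \<and>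
     convex hull A \<inter> convex hull (X \<union> Y - A) = {})"

lemma splits_commute: "splits X Y x y \<longleftrightarrow> splits Y X y x"
  unfolding splits_def by (auto simp: Un_commute)

lemma lowest_subset:
  fixes f :: "'a \<Rightarrow> 'b::linorder"
  assumes "finite S" "n \<le> card S"
  shows "\<exists>A\<subseteq>S. card A = n \<and> (\<forall>a\<in>A. \<forall>q\<in>S - A. f a \<le> f q)"
  using assms(2)
proof (induction n)
  case 0
  then show ?case by (intro exI[of _ "{}"]) auto
next
  case (Suc n)
  then obtain A where A: "A \<subseteq> S" "card A = n" "\<forall>a\<in>A. \<forall>q\<in>S - A. f a \<le> f q" by auto
  have finA: "finite A" using A assms finite_subset by blast
  have "S - A \<noteq> {}" using A Suc.prems assms(1) card_mono[OF finA, of S] by auto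
  then obtain m where m: "m \<in> S - A" "\<forall>q\<in>S - A. f m \<le> f q"
    using assms(1) arg_min_if_finite[of "S - A" f] by (metis finite_Diff linorder_not_le)
  then show ?case
    using A finA by (intro exI[of _ "insert m A"]) auto
qed

text \<open>As \<open>A\<close> has too many points of \<open>X\<close>, more than
  \<open>card Y - y\<close> points of \<open>Y\<close> lie outside it. Only a tie can spoil
  strictness. General position allows a single tied pair; exchanging it yields the missing split, or
  dropping its point of \<open>X\<close> leaves enough points.\<close>

lemma precedes_of_prefix:
  assumes fin: "finite X" "finite Y" and "X \<inter> Y = {}" and gp: "general_position (X \<union> Y)"
    and u: "u \<noteq> 0" and nsplit: "\<not> splits X Y x y" and y: "y \<le> card Y"
    and A: "A \<subseteq> X \<union> Y" "card A = x + y" "x < card (A \<inter> X)"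
    and le: "\<And>a q. a \<in> A \<Longrightarrow> q \<in> X \<union> Y - A \<Longrightarrow> u \<bullet> a \<le> u \<bullet> q"
  shows "precedes X (x + 1) Y (card Y - y + 1) u"
proof -
  have finA: "finite A" using fin A finite_subset by blast
  have "A = (A \<inter> X) \<union> (A \<inter> Y)" using A by blast
  moreover have "(A \<inter> X) \<inter> (A \<inter> Y) = {}" using assms(3) by blast
  ultimately have cA: "card (A \<inter> X) + card (A \<inter> Y) = x + y"
    using A(2) finA by (metis card_Un_disjoint finite_Int)
  have "card (Y - A) = card Y - card (A \<inter> Y)"
    using fin by (metis Int_commute card_Diff_subset_Int finA finite_Int)
  then have cY: "card Y - y + 1 \<le> card (Y - A)"
    using cA A(3) y by linarith
  show ?thesis
  proof (cases "\<exists>a\<in>A \<inter> X. \<exists>q\<in>Y - A. u \<bullet> a = u \<bullet> q")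
    case False
    have "u \<bullet> p < u \<bullet> q" if "p \<in> A \<inter> X" "q \<in> Y - A" for p q
    proof -
      have "u \<bullet> p \<le> u \<bullet> q" using le[of p q] that by auto
      moreover have "u \<bullet> p \<noteq> u \<bullet> q" using False that by blast
      ultimately show ?thesis by simp
    qed
    then show ?thesis
      using A(3) cY by (intro precedesI[of "A \<inter> X" _ "Y - A"]) auto
  next
    case True
    then obtain a q where aq: "a \<in> A" "a \<in> X" "q \<in> Y" "q \<notin> A" "u \<bullet> a = u \<bullet> q" by blast
    have "a \<noteq> q" using aq by blast
    \<comment> \<open>Any tie between \<open>A\<close> and \<open>Y - A\<close> sits at the level
      shared by \<open>a\<close> and \<open>q\<close>, which holds no third point.\<close>
    have tie: "p = a" if "p \<in> A" "s \<in> Y - A" "u \<bullet> p = u \<bullet> s" for p s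
    proof -
      have "u \<bullet> p \<le> u \<bullet> q" "u \<bullet> a \<le> u \<bullet> s" using le[of p q] le[of a s] that aq by auto
      then have "u \<bullet> p = u \<bullet> a" using that aq by simp
      then show ?thesis
        using general_position_level[OF gp u, of p a q] aq that A(1) by auto
    qed
    show ?thesis
    proof (cases "card (A \<inter> X) = x + 1")
      case True
      \<comment> \<open>After the exchange, \<open>A'\<close> is still a lowest set for
        \<open>u\<close> and has exactly \<open>x\<close> points of \<open>X\<close>.\<close>
      define A' where "A' = insert q (A - {a})"
      have "A' \<inter> X = (A \<inter> X) - {a}" "A' \<inter> Y = insert q (A \<inter> Y)"
        using aq assms(3) by (auto simp: A'_def)
      then have "card (A' \<inter> X) = x" "card (A' \<inter> Y) = y"
        using True cA aq finA by auto
      moreover have "convex hull A' \<inter> convex hull (X \<union> Y - A') = {}"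
      proof (rule weakly_separated_hulls_disjoint[OF _ gp u])
        show "A' \<subseteq> X \<union> Y" using A(1) aq by (auto simp: A'_def)
        show "u \<bullet> p \<le> u \<bullet> s" if ps: "p \<in> A'" "s \<in> X \<union> Y - A'" for p s
        proof -
          consider "s = a" | "s \<in> X \<union> Y - A" using ps by (auto simp: A'_def)
          then show ?thesis
          proof cases
            case 1
            then show ?thesis using ps le[of p q] aq by (auto simp: A'_def)
          next
            case 2
            then show ?thesis using ps le[of p s] le[of a s] aq by (auto simp: A'_def)
          qed
        qed
      qed (use fin in auto)
      ultimately have "splits X Y x y"
        unfolding splits_def using A(1) aq by (intro exI[of _ A']) (auto simp: A'_def)
      then show ?thesis using nsplit by blast
    next
      case False
      have "u \<bullet> p < u \<bullet> s" if "p \<in> A \<inter> X - {a}" "s \<in> Y - A" for p s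
      proof -
        have "u \<bullet> p \<le> u \<bullet> s" using le[of p s] that by auto
        moreover have "u \<bullet> p \<noteq> u \<bullet> s" using tie[of p s] that by blast
        ultimately show ?thesis by simp
      qed
      moreover have "x + 1 \<le> card (A \<inter> X - {a})"
        using False A(3) aq finA by simp
      ultimately show ?thesis
        using cY by (intro precedesI[of "A \<inter> X - {a}" _ "Y - A"]) auto
    qed
  qed
qed

lemma precedes_of_not_splits:
  assumes fin: "finite X" "finite Y" and dis: "X \<inter> Y = {}" and gp: "general_position (X \<union> Y)"
    and u: "u \<noteq> 0" and nsplit: "\<not> splits X Y x y" and xy: "x \<le> card X" "y \<le> card Y"
  shows "precedes X (x + 1) Y (card Y - y + 1) u \<or> precedes Y (y + 1) X (card X - x + 1) u"
proof -
  have "x + y \<le> card (X \<union> Y)" using fin dis xy by (simp add: card_Un_disjoint)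
  then obtain A where A: "A \<subseteq> X \<union> Y" "card A = x + y"
    and le: "\<forall>a\<in>A. \<forall>q\<in>X \<union> Y - A. u \<bullet> a \<le> u \<bullet> q"
    using lowest_subset[of "X \<union> Y" "x + y" "\<lambda>p. u \<bullet> p"] fin by auto
  have finA: "finite A" using fin A finite_subset by blast
  have "A = (A \<inter> X) \<union> (A \<inter> Y)" using A by blast
  moreover have "(A \<inter> X) \<inter> (A \<inter> Y) = {}" using dis by blast
  ultimately have cA: "card (A \<inter> X) + card (A \<inter> Y) = x + y"
    using A(2) finA by (metis card_Un_disjoint finite_Int)
  consider "x < card (A \<inter> X)" | "y < card (A \<inter> Y)" | "card (A \<inter> X) = x" "card (A \<inter> Y) = y"
    using cA by linarith
  then show ?thesis
  proof cases
    case 1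
    then show ?thesis
      using precedes_of_prefix[OF fin dis gp u nsplit xy(2) A] le by blast
  next
    case 2
    have "precedes Y (y + 1) X (card X - x + 1) u"
    proof (rule precedes_of_prefix[OF fin(2,1) _ _ u _ xy(1)])
      show "\<not> splits Y X y x" using nsplit splits_commute by blast
      show "A \<subseteq> Y \<union> X" "card A = y + x" using A by auto
      show "u \<bullet> a \<le> u \<bullet> q" if "a \<in> A" "q \<in> Y \<union> X - A" for a q using that le by auto
    qed (use dis gp 2 in \<open>auto simp: Un_commute\<close>)
    then show ?thesis by blast
  next
    case 3
    have "splits X Y x y"
      unfolding splits_def
      using weakly_separated_hulls_disjoint[OF _ gp u A(1)] le fin A 3 by blast
    then show ?thesis using nsplit by blast
  qed
qed

text \<open>The sizes in the two alternatives add up to \<open>card X + 2\<close> and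
  \<open>card Y + 2\<close>, so no direction satisfies both.\<close>

lemma not_splits_dichotomy:
  assumes "finite X" "finite Y" "X \<inter> Y = {}" "general_position (X \<union> Y)"
    and "\<not> splits X Y x y" "x \<le> card X" "y \<le> card Y"
  shows "(\<forall>u. u \<noteq> 0 \<longrightarrow> precedes X (x + 1) Y (card Y - y + 1) u) \<or>
         (\<forall>u. u \<noteq> 0 \<longrightarrow> precedes Y (y + 1) X (card X - x + 1) u)"
proof (rule precedes_dichotomy)
  show "precedes X (x + 1) Y (card Y - y + 1) u \<or> precedes Y (y + 1) X (card X - x + 1) u"
    if "u \<noteq> 0" for u
    using precedes_of_not_splits[OF assms(1-4) that assms(5-7)] .
qed (use assms in auto)

section \<open>Rotation arguments and the balanced split\<close>

lemma complementary_subsets: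
  assumes "finite Y" "Y1 \<subseteq> Y" "Y2 \<subseteq> Y" "Y1 \<inter> Y2 = {}" "card Y \<le> card Y1 + card Y2"
  shows "Y1 \<union> Y2 = Y"
proof (rule card_seteq)
  have "card (Y1 \<union> Y2) = card Y1 + card Y2"
    using assms by (meson card_Un_disjoint finite_subset)
  then show "card Y \<le> card (Y1 \<union> Y2)" using assms(5) by simp
qed (use assms in auto)

text \<open>
  The assumptions say that the \<open>(x + 1)\<close>-st point of \<open>X\<close> always has exactly \<open>s\<close> points of \<open>Y\<close> before
  it. Then no point of \<open>Y\<close> changes sides as \<open>u\<close> rotates, not even from \<open>u\<close> to \<open>-u\<close>.
\<close>

lemma not_always_straddled:
  fixes X Y :: "'a::euclidean_space set"
  assumes dim: "2 \<le> DIM('a)" and fin: "finite X" "finite Y"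
    and up: "\<forall>u. u \<noteq> 0 \<longrightarrow> precedes Y s X (card X - x) u"
    and down: "\<forall>u. u \<noteq> 0 \<longrightarrow> precedes X (x + 1) Y (card Y - s) u"
    and s: "1 \<le> s" "s \<le> card Y" and x: "2 * x < card X"
  shows False
proof -
  have later: "\<forall>u. u \<noteq> 0 \<longrightarrow> precedes X (x + 1) {c} 1 u" if "c \<in> Y" for c
  proof -
    have "precedes {c} 1 X (card X - x) u \<or> precedes X (x + 1) {c} 1 u" if "u \<noteq> 0" for u
    proof -
      obtain Y1 X1 where 1: "Y1 \<subseteq> Y" "X1 \<subseteq> X" "card Y1 = s" "card X1 = card X - x"
        "\<And>p q. p \<in> Y1 \<Longrightarrow> q \<in> X1 \<Longrightarrow> u \<bullet> p < u \<bullet> q"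
        using up \<open>u \<noteq> 0\<close> by (metis precedesE)
      obtain X2 Y2 where 2: "X2 \<subseteq> X" "Y2 \<subseteq> Y" "card X2 = x + 1" "card Y2 = card Y - s"
        "\<And>p q. p \<in> X2 \<Longrightarrow> q \<in> Y2 \<Longrightarrow> u \<bullet> p < u \<bullet> q"
        using down \<open>u \<noteq> 0\<close> by (metis precedesE)
      \<comment> \<open>The sizes of \<open>X1\<close> and \<open>X2\<close> add up to
        \<open>card X + 1\<close>. A common point \<open>m\<close> lies after all of
        \<open>Y1\<close> and before all of \<open>Y2\<close>, so these partition
        \<open>Y\<close>.\<close>
      obtain m where m: "m \<in> X1" "m \<in> X2"
        using subsets_meet[OF fin(1) 1(2) 2(1)] 1(4) 2(3) x by auto
      have "Y1 \<inter> Y2 = {}" using 1(5) 2(5) m by fastforce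
      then have "Y1 \<union> Y2 = Y"
        using complementary_subsets[OF fin(2) 1(1) 2(2)] 1(3) 2(4) s by auto
      then consider "c \<in> Y1" | "c \<in> Y2" using \<open>c \<in> Y\<close> by blast
      then show ?thesis
      proof cases
        case 1
        then have "precedes {c} 1 X (card X - x) u"
          using \<open>X1 \<subseteq> X\<close> \<open>card X1 = card X - x\<close> \<open>\<And>p q. p \<in> Y1 \<Longrightarrow> q \<in> X1 \<Longrightarrow> u \<bullet> p < u \<bullet> q\<close>
          by (intro precedesI[of "{c}" _ X1]) auto
        then show ?thesis ..
      next
        case 2
        then have "precedes X (x + 1) {c} 1 u"
          using \<open>X2 \<subseteq> X\<close> \<open>card X2 = x + 1\<close> \<open>\<And>p q. p \<in> X2 \<Longrightarrow> q \<in> Y2 \<Longrightarrow> u \<bullet> p < u \<bullet> q\<close>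
          by (intro precedesI[of X2 _ "{c}"]) auto
        then show ?thesis ..
      qed
    qed
    then have "(\<forall>u. u \<noteq> 0 \<longrightarrow> precedes {c} 1 X (card X - x) u) \<or>
        (\<forall>u. u \<noteq> 0 \<longrightarrow> precedes X (x + 1) {c} 1 u)"
      using dim fin x by (intro precedes_dichotomy) auto
    \<comment> \<open>Otherwise \<open>c\<close> would lie before more than half of \<open>X\<close>
      both for \<open>u\<close> and for \<open>- u\<close>.\<close>
    moreover have "\<not> (\<forall>u. u \<noteq> 0 \<longrightarrow> precedes {c} 1 X (card X - x) u)"
      using precedes_always_bound[of "{c}" X 1 "card X - x"] fin x by fastforce
    ultimately show ?thesis by blast
  qed
  obtain u :: 'a where u: "u \<noteq> 0" using nonzero_Basis SOME_Basis by blast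
  obtain Y1 X1 where 1: "Y1 \<subseteq> Y" "X1 \<subseteq> X" "card Y1 = s" "card X1 = card X - x"
    "\<And>p q. p \<in> Y1 \<Longrightarrow> q \<in> X1 \<Longrightarrow> u \<bullet> p < u \<bullet> q"
    using up u by (metis precedesE)
  \<comment> \<open>As \<open>1 \<le> s\<close>, there is a point of \<open>Y\<close> on the side
    that \<open>later\<close> excludes.\<close>
  obtain c where c: "c \<in> Y1" using 1(3) s by fastforce
  then have "precedes {c} 1 X (card X - x) u"
    using 1 by (intro precedesI[of "{c}" _ X1]) auto
  moreover have "precedes X (x + 1) {c} 1 u" using later c 1(1) u by blast
  ultimately show False
    using precedes_clash[of "{c}" X 1 "card X - x" u "x + 1" 1] fin x by auto
qed

text \<open>A point \<open>c\<close> of \<open>X\<close> lies in one of the two halves, hence before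
  or after \<open>h\<close> of the \<open>2 * h - 1\<close> other points. These cases exclude each
  other, so \<open>c\<close> keeps its side for all \<open>u\<close>, although \<open>- u\<close>
  swaps the sides.\<close>

lemma not_always_halved:
  fixes X :: "'a::euclidean_space set"
  assumes dim: "2 \<le> DIM('a)" and fin: "finite X" and card: "card X = 2 * h" "0 < h"
    and halved: "\<forall>u. u \<noteq> 0 \<longrightarrow> precedes X h X h u"
  shows False
proof -
  obtain c where c: "c \<in> X" using card by fastforce
  have cX: "card (X - {c}) < h + h" using c fin card by simp
  have "precedes {c} 1 (X - {c}) h u \<or> precedes (X - {c}) h {c} 1 u" if "u \<noteq> 0" for u
  proof -
    obtain X1 X2 where X12: "X1 \<subseteq> X" "X2 \<subseteq> X" "card X1 = h" "card X2 = h"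
      and less: "\<And>p q. p \<in> X1 \<Longrightarrow> q \<in> X2 \<Longrightarrow> u \<bullet> p < u \<bullet> q"
      using halved \<open>u \<noteq> 0\<close> by (metis precedesE)
    have dis: "X1 \<inter> X2 = {}" using less by fastforce
    then have "X1 \<union> X2 = X"
      using complementary_subsets[OF fin X12(1,2)] X12 card by auto
    then consider "c \<in> X1" | "c \<in> X2" using c by blast
    then show ?thesis
    proof cases
      case 1
      then have "precedes {c} 1 (X - {c}) h u"
        using X12 less dis by (intro precedesI[of "{c}" _ X2]) auto
      then show ?thesis ..
    next
      case 2
      then have "precedes (X - {c}) h {c} 1 u"
        using X12 less dis by (intro precedesI[of X1 _ "{c}"]) auto
      then show ?thesis ..
    qed
  qed
  then have "(\<forall>u. u \<noteq> 0 \<longrightarrow> precedes {c} 1 (X - {c}) h u) \<or>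
      (\<forall>u. u \<noteq> 0 \<longrightarrow> precedes (X - {c}) h {c} 1 u)"
    using dim fin cX by (intro precedes_dichotomy) auto
  then have "\<forall>u. u \<noteq> 0 \<longrightarrow> precedes {c} 1 (X - {c}) h u"
    using precedes_always_sym by blast
  then show False
    using precedes_always_bound[of "{c}" "X - {c}" 1 h] fin cX by auto
qed

text \<open>The total weight is \<open>7 * (j + j')\<close>, and the first part weighs
  \<open>7 * j\<close>. The bounds on \<open>x\<close> say that the parts keep at least
  \<open>j\<close> and \<open>j'\<close> blue points. Without a split, \<open>down\<close> holds at
  the least such \<open>x\<close>, propagates up to \<open>3 * j\<close>, and is refuted
  there.\<close>

lemma balanced_split:
  assumes fin: "finite R" "finite B" and dis: "R \<inter> B = {}" and gp: "general_position (R \<union> B)"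
    and j: "1 \<le> j" "j \<le> j'" "j' \<le> j + 1" and i: "1 \<le> i" "i < j + j'"
    and r: "card R = 2 * (j + j') + i" and b: "card B + 2 * i = 3 * (j + j')"
  shows "\<exists>x. 2 * j + i \<le> x + j' \<and> x \<le> 3 * j \<and> splits R B x (7 * j - 2 * x)"
proof (rule ccontr)
  assume "\<not> ?thesis"
  have r': "card R = 2 * j + 2 * j' + i" and b': "card B + 2 * i = 3 * j + 3 * j'"
    using r b by simp_all
  from \<open>\<not> ?thesis\<close> have none: "\<not> splits R B x (7 * j - 2 * x)" if "2 * j + i \<le> x + j'" "x \<le> 3 * j" for x
    using that by blast
  \<comment> \<open>\<open>up x\<close>: all paths run above \<open>(x, 7 j - 2 x)\<close>; \<open>down x\<close>: all paths run below it.\<close>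
  define up where "up x \<longleftrightarrow> (\<forall>u. u \<noteq> 0 \<longrightarrow>
    precedes B (7 * j - 2 * x + 1) R (card R - x + 1) u)" for x
  define down where "down x \<longleftrightarrow> (\<forall>u. u \<noteq> 0 \<longrightarrow>
    precedes R (x + 1) B (card B - (7 * j - 2 * x) + 1) u)" for x
  have up_or_down: "down x \<or> up x" if "2 * j + i \<le> x + j'" "x \<le> 3 * j" for x
  proof -
    have "x \<le> card R" using that r' j by linarith
    moreover have "7 * j - 2 * x \<le> card B" using that r' b' j i by linarith
    ultimately show ?thesis
      unfolding up_def down_def by (rule not_splits_dichotomy[OF fin dis gp none[OF that]])
  qed
  define lo where "lo = 2 * j + i - j'"
  have lo: "lo + j' = 2 * j + i" "lo \<le> 3 * j" unfolding lo_def using i j by auto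
  \<comment> \<open>The pair at \<open>lo\<close> lies to the left of and above the center of the
    paths, so by reflection not all of them run above it.\<close>
  have "\<not> up lo"
  proof
    assume "up lo"
    then have "2 * (7 * j - 2 * lo + 1) \<le> card B \<or> 2 * (card R - lo + 1) \<le> card R"
      unfolding up_def by (rule precedes_always_bound[OF fin(2,1)])
    then show False using lo r' b' i j unfolding distrib_left by linarith
  qed
  then have "down lo" using up_or_down[of lo] lo by auto
  \<comment> \<open>\<open>down x\<close> and \<open>up (x + 1)\<close> force every path through the same red step.\<close>
  have descend: "down (Suc x)" if "down x" "lo \<le> x" "Suc x \<le> 3 * j" for x
  proof (rule ccontr)
    assume "\<not> down (Suc x)"
    then have "up (Suc x)" using up_or_down[of "Suc x"] that lo by auto
    \<comment> \<open>Running below \<open>(x, s + 1)\<close> and above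
      \<open>(x + 1, s - 1)\<close> forces the red step from \<open>x\<close> to
      \<open>x + 1\<close> to happen at height \<open>s\<close>.\<close>
    define s where "s = 7 * j - 2 * x - 1"
    have x: "7 * j = 2 * x + s + 1" "1 \<le> s" "s \<le> card B" "Suc x \<le> card R"
      unfolding s_def using that lo r' b' i j by linarith+
    then have s: "7 * j - 2 * Suc x + 1 = s" "card R - Suc x + 1 = card R - x"
      "card B - (7 * j - 2 * x) + 1 = card B - s" "1 \<le> s" "s \<le> card B"
      using r' b' lo that j i unfolding mult_Suc_right by linarith+
    \<comment> \<open>Both alternatives give \<open>2 * x < card R\<close>, the second because
      \<open>7 * j\<close> is at most half of the total weight.\<close>
    have "2 * (x + 1) \<le> card R \<or> 2 * (card B - s) \<le> card B"
      using precedes_always_bound[OF fin] \<open>down x\<close> unfolding down_def s(3) by blast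
    then have "2 * x < card R"
      unfolding s_def distrib_left diff_mult_distrib2 using r' b' j i that lo by linarith
    then show False
      using not_always_straddled[OF _ fin, of s x] \<open>up (Suc x)\<close> \<open>down x\<close> s(4,5)
      unfolding up_def down_def s(1-3) by simp
  qed
  have "down x" if "lo \<le> x" "x \<le> 3 * j" for x
    using that
  proof (induction x rule: dec_induct)
    case base
    then show ?case using \<open>down lo\<close> by blast
  next
    case (step n)
    then show ?case using descend[of n] by auto
  qed
  then have "down (3 * j)" using lo by blast
  then have top: "\<forall>u. u \<noteq> 0 \<longrightarrow> precedes R (3 * j + 1) B (card B - j + 1) u"
    unfolding down_def by simp
  then have "2 * (3 * j + 1) \<le> card R \<or> 2 * (card B - j + 1) \<le> card B"
    using precedes_always_bound[OF fin] by blast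
  \<comment> \<open>Only here does reflection alone give no contradiction: \<open>card R\<close> is
    exactly \<open>2 * (3 * j + 1)\<close>, so the bound is attained.\<close>
  then have exceptional: "i = 2 * j" "j' = j + 1" using r' b' i j unfolding distrib_left diff_mult_distrib2 by linarith+
  \<comment> \<open>In both \<open>top\<close> and its reversal more than half of the blue points occur, so some blue point
    always separates the two halves of \<open>R\<close>.\<close>
  have "precedes R (3 * j + 1) R (3 * j + 1) u" if "u \<noteq> 0" for u
  proof -
    obtain R1 B1 where 1: "R1 \<subseteq> R" "B1 \<subseteq> B" "card R1 = 3 * j + 1" "card B1 = card B - j + 1"
      "\<And>p q. p \<in> R1 \<Longrightarrow> q \<in> B1 \<Longrightarrow> u \<bullet> p < u \<bullet> q"
      using top \<open>u \<noteq> 0\<close> by (metis precedesE)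
    obtain B2 R2 where 2: "B2 \<subseteq> B" "R2 \<subseteq> R" "card B2 = card B - j + 1" "card R2 = 3 * j + 1"
      "\<And>p q. p \<in> B2 \<Longrightarrow> q \<in> R2 \<Longrightarrow> u \<bullet> p < u \<bullet> q"
      using precedes_always_sym[OF top] \<open>u \<noteq> 0\<close> by (metis precedesE)
    obtain m where m: "m \<in> B1" "m \<in> B2"
      using subsets_meet[OF fin(2) 1(2) 2(1)] 1(4) 2(3) b' exceptional by auto
    have "u \<bullet> p < u \<bullet> q" if "p \<in> R1" "q \<in> R2" for p q
      using 1(5)[OF that(1) m(1)] 2(5)[OF m(2) that(2)] by (rule less_trans)
    then show ?thesis
      using 1(1,3) 2(2,4) by (intro precedesI[of R1 _ R2]) auto
  qed
  then show False
    using not_always_halved[of R "3 * j + 1"] fin r' exceptional by auto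
qed

section \<open>Combining covers\<close>

lemma K13_coverable_mono:
  assumes "K13_coverable R B X" "R \<subseteq> R'" "B \<subseteq> B'"
  shows "K13_coverable R' B' X"
proof -
  have "K13_block R' B' c A" if "K13_block R B c A" for c A
    using that assms(2,3) unfolding K13_block_def by blast
  then show ?thesis using assms(1) unfolding K13_coverable_def by meson
qed

lemma K13_coverable_commute: "K13_coverable R B X \<longleftrightarrow> K13_coverable B R X"
proof -
  have "K13_block R B = K13_block B R" unfolding K13_block_def by (intro ext) blast
  then show ?thesis unfolding K13_coverable_def by simp
qed

lemma star_edges_segment:
  assumes "partition_on X P" "\<forall>A\<in>P. c A \<in> A" "e \<in> star_edges P c"
  shows "closed_segment (fst e) (snd e) \<subseteq> convex hull X"
proof -
  obtain A y where A: "A \<in> P" "y \<in> A - {c A}" "e = (c A, y)"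
    using assms(3) unfolding star_edges_def by blast
  have "A \<subseteq> X" using assms(1) A(1) unfolding partition_on_def by blast
  then have "{c A, y} \<subseteq> X" using A assms(2) by blast
  then show ?thesis
    unfolding A(3) fst_conv snd_conv segment_convex_hull by (rule hull_mono)
qed

text \<open>All segments of a cover lie in the hull of the covered set, so segments of the two
  covers never meet.\<close>

lemma K13_coverable_Un:
  assumes "K13_coverable R B X" "K13_coverable R B Y" and hulls: "convex hull X \<inter> convex hull Y = {}"
  shows "K13_coverable R B (X \<union> Y)"
proof -
  obtain P c where P: "partition_on X P" "\<forall>A\<in>P. K13_block R B (c A) A" "pairwise noncrossing (star_edges P c)"
    using assms(1) unfolding K13_coverable_def by blast
  obtain Q d where Q: "partition_on Y Q" "\<forall>A\<in>Q. K13_block R B (d A) A" "pairwise noncrossing (star_edges Q d)"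
    using assms(2) unfolding K13_coverable_def by blast
  have XY: "X \<inter> Y = {}" using hulls hull_subset[of X convex] hull_subset[of Y convex] by blast
  have PQ: "A \<notin> P" if "A \<in> Q" for A
  proof
    assume "A \<in> P"
    then have "A \<subseteq> X" "A \<subseteq> Y" "A \<noteq> {}"
      using \<open>A \<in> Q\<close> P(1) Q(1) unfolding partition_on_def by auto
    then show False using XY by blast
  qed
  \<comment> \<open>\<open>P\<close> and \<open>Q\<close> share no block, so \<open>f\<close> agrees
    with \<open>d\<close> on all of \<open>Q\<close>.\<close>
  define f where "f A = (if A \<in> P then c A else d A)" for A
  have block: "\<forall>A\<in>P \<union> Q. K13_block R B (f A) A" using P(2) Q(2) by (auto simp: f_def)
  have f: "f A = c A" if "A \<in> P" for A using that by (simp add: f_def)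
  have g: "f A = d A" if "A \<in> Q" for A using that PQ by (auto simp: f_def)
  have edges: "star_edges (P \<union> Q) f = star_edges P c \<union> star_edges Q d"
    unfolding star_edges_def using f g by (auto; metis)
  have segP: "closed_segment (fst e) (snd e) \<subseteq> convex hull X" if "e \<in> star_edges P c" for e
    using star_edges_segment[OF P(1) _ that] P(2) unfolding K13_block_def by blast
  have segQ: "closed_segment (fst e) (snd e) \<subseteq> convex hull Y" if "e \<in> star_edges Q d" for e
    using star_edges_segment[OF Q(1) _ that] Q(2) unfolding K13_block_def by blast
  have "noncrossing e e'" "noncrossing e' e" if "e \<in> star_edges P c" "e' \<in> star_edges Q d" for e e'
    using segP[OF that(1)] segQ[OF that(2)] hulls unfolding noncrossing_def by blast+
  then have "pairwise noncrossing (star_edges (P \<union> Q) f)"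
    unfolding edges using P(3) Q(3) by (auto simp: pairwise_def)
  moreover have "partition_on (X \<union> Y) (P \<union> Q)"
  proof (rule partition_onI)
    show "\<Union> (P \<union> Q) = X \<union> Y" "{} \<notin> P \<union> Q" using P(1) Q(1) unfolding partition_on_def by auto
    show "disjnt A A'" if "A \<in> P \<union> Q" "A' \<in> P \<union> Q" "A \<noteq> A'" for A A'
    proof -
      have "pairwise disjnt P" "pairwise disjnt Q" "\<Union> P = X" "\<Union> Q = Y"
        using P(1) Q(1) unfolding partition_on_def by auto
      moreover have "disjnt U V" "disjnt V U" if "U \<in> P" "V \<in> Q" for U V
        using that \<open>\<Union> P = X\<close> \<open>\<Union> Q = Y\<close> XY unfolding disjnt_iff by blast+
      ultimately show ?thesis using that unfolding pairwise_def by auto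
    qed
  qed
  ultimately show ?thesis using block unfolding K13_coverable_def by blast
qed

section \<open>Shortest assignments with all centers in one color\<close>

lemma exists_equal_fibers:
  assumes "finite X" "finite Y" "card Y = 3 * card X"
  shows "\<exists>f \<in> Y \<rightarrow> X. \<forall>a\<in>X. card {y \<in> Y. f y = a} = 3"
  using assms
proof (induction X arbitrary: Y rule: finite_induct)
  case empty
  then show ?case by auto
next
  case (insert a X)
  have cY: "card Y = 3 * card X + 3" using insert.hyps insert.prems by simp
  obtain Z where Z: "Z \<subseteq> Y" "card Z = 3" "finite Z"
    using obtain_subset_with_card_n[of 3 Y] cY by auto
  have "card (Y - Z) = 3 * card X"
    using cY Z by (simp add: card_Diff_subset)
  then obtain f where f: "f \<in> (Y - Z) \<rightarrow> X" "\<forall>a\<in>X. card {y \<in> Y - Z. f y = a} = 3"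
    using insert.IH[of "Y - Z"] insert.prems by auto
  define g where "g y = (if y \<in> Z then a else f y)" for y
  have "{y \<in> Y. g y = a} = Z" using Z f insert.hyps by (auto simp: g_def Pi_iff)
  moreover have "{y \<in> Y. g y = a'} = {y \<in> Y - Z. f y = a'}" if "a' \<in> X" for a'
    using that insert.hyps by (auto simp: g_def)
  ultimately show ?case
    using Z f by (intro bexI[of _ g]) (auto simp: g_def Pi_iff)
qed

text \<open>A common point other than \<open>a\<close> would put \<open>y\<close> and
  \<open>y'\<close> on the same line through \<open>a\<close>.\<close>

lemma noncollinear_segments:
  fixes a :: "'a::euclidean_space"
  assumes "\<not> collinear {a, y, y'}" "z \<in> closed_segment a y" "z \<in> closed_segment a y'"
  shows "z = a"
proof (rule ccontr)
  assume "z \<noteq> a"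
  have "collinear {a, z, y}" "collinear {a, z, y'}"
    using assms(2,3) between_imp_collinear[of a y z] between_imp_collinear[of a y' z]
    unfolding between_mem_segment by auto
  then have "collinear {a, y, y'}"
    using collinear_3_trans[of y a z y'] \<open>z \<noteq> a\<close> by (simp add: insert_commute)
  then show False using assms(1) by blast
qed

text \<open>Add two triangle inequalities through \<open>z\<close>. Equality in the first would put
  \<open>z\<close> on the segment from \<open>a\<close> to \<open>y'\<close>, so
  \<open>z = a\<close>, and then \<open>a\<close> would lie between \<open>a'\<close> and
  \<open>y'\<close>.\<close>

lemma swap_crossing_shorter:
  assumes gp: "general_position S" and mem: "a \<in> S" "a' \<in> S" "y \<in> S" "y' \<in> S"
    and d: "distinct [a, a', y, y']"
    and z: "z \<in> closed_segment a y" "z \<in> closed_segment a' y'"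
  shows "dist a y' + dist a' y < dist a y + dist a' y'"
proof -
  have le: "dist a y' \<le> dist a z + dist z y'" "dist a' y \<le> dist a' z + dist z y"
    by (rule dist_triangle)+
  have eq: "dist a y = dist a z + dist z y" "dist a' y' = dist a' z + dist z y'"
    using z by (auto simp: between_mem_segment[symmetric] between)
  have nc: "\<not> collinear {a, y, y'}" "\<not> collinear {a', a, y'}"
    using gp mem d unfolding general_position_def by auto
  have "dist a y' \<noteq> dist a z + dist z y'"
  proof
    assume "dist a y' = dist a z + dist z y'"
    then have "z \<in> closed_segment a y'"
      by (auto simp: between_mem_segment[symmetric] between)
    then have "z = a" using noncollinear_segments[OF nc(1) z(1)] by blast
    then have "collinear {a', a, y'}"
      using z(2) between_imp_collinear[of a' y' a] unfolding between_mem_segment by auto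
    then show False using nc(2) by blast
  qed
  then show ?thesis using le eq by linarith
qed

text \<open>Edges with a common center meet only there by general position; if edges from different
  centers met, swapping their leaves would contradict minimality.\<close>

lemma K13_coverable_one_center_color:
  assumes fin: "finite X" "finite Y" and dis: "X \<inter> Y = {}" and gp: "general_position (X \<union> Y)"
    and card: "card Y = 3 * card X"
  shows "K13_coverable X Y (X \<union> Y)"
proof -
  \<comment> \<open>Being extensional on \<open>Y\<close> makes \<open>F\<close> finite, so a
    shortest assignment exists.\<close>
  define F where "F = {f \<in> Y \<rightarrow>\<^sub>E X. \<forall>a\<in>X. card {y \<in> Y. f y = a} = 3}"
  define len where "len f = (\<Sum>y\<in>Y. dist (f y) y)" for f :: "point \<Rightarrow> point"
  have "finite F" unfolding F_def using fin by (simp add: finite_PiE)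
  moreover have "F \<noteq> {}"
  proof -
    obtain f where f: "f \<in> Y \<rightarrow> X" "\<forall>a\<in>X. card {y \<in> Y. f y = a} = 3"
      using exists_equal_fibers[OF fin card] by blast
    have "{y \<in> Y. restrict f Y y = a} = {y \<in> Y. f y = a}" for a by auto
    then have "restrict f Y \<in> F" unfolding F_def using f by simp
    then show ?thesis by blast
  qed
  ultimately obtain f where f: "f \<in> F" and min: "\<And>g. g \<in> F \<Longrightarrow> len f \<le> len g"
    using arg_min_if_finite[of F len] by (metis linorder_not_le)
  have fX: "f y \<in> X" if "y \<in> Y" for y using f that unfolding F_def by auto
  have fiber: "card {y \<in> Y. f y = a} = 3" if "a \<in> X" for a using f that unfolding F_def by auto
  have nc: "noncrossing (f y, y) (f y', y')" if y: "y \<in> Y" "y' \<in> Y" "y \<noteq> y'" for y y'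
  proof (cases "f y = f y'")
    case True
    have "f y \<noteq> y" "f y \<noteq> y'" using fX[OF y(1)] y dis by auto
    then have "\<not> collinear {f y, y, y'}"
      using gp[unfolded general_position_def, rule_format, of "f y" y y'] y fX[of y] dis by auto
    then show ?thesis
      using noncollinear_segments[of "f y" y y'] True unfolding noncrossing_def by auto
  next
    case False
    have "closed_segment (f y) y \<inter> closed_segment (f y') y' = {}"
    proof (rule ccontr)
      assume "\<not> ?thesis"
      then obtain z where "z \<in> closed_segment (f y) y" "z \<in> closed_segment (f y') y'" by blast
      moreover have "distinct [f y, f y', y, y']" using False y fX[OF y(1)] fX[OF y(2)] dis by auto
      ultimately have shorter: "dist (f y) y' + dist (f y') y < dist (f y) y + dist (f y') y'"
        using swap_crossing_shorter[OF gp] y fX by blast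
      \<comment> \<open>The fibers of \<open>g\<close> are images of those of \<open>f\<close> under
        a bijection, so they keep size 3.\<close>
      define g where "g = f \<circ> Transposition.transpose y y'"
      have "g \<in> F"
      proof -
        have "g \<in> Y \<rightarrow>\<^sub>E X"
          using f y unfolding F_def g_def by (auto simp: PiE_iff extensional_def Transposition.transpose_def)
        moreover have "card {v \<in> Y. g v = a} = 3" if "a \<in> X" for a
        proof -
          have "{v \<in> Y. g v = a} = Transposition.transpose y y' ` {v \<in> Y. f v = a}"
            using y by (auto simp: g_def Transposition.transpose_def image_iff split: if_splits)
          then show ?thesis using fiber[OF that] by (simp add: card_image)
        qed
        ultimately show ?thesis unfolding F_def by blast
      qed
      have split: "len h = dist (h y) y + dist (h y') y' + (\<Sum>v\<in>Y - {y, y'}. dist (h v) v)" for h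
      proof -
        have "len h = sum (\<lambda>v. dist (h v) v) (Y - {y, y'}) + sum (\<lambda>v. dist (h v) v) {y, y'}"
          unfolding len_def using y fin by (intro sum.subset_diff) auto
        then show ?thesis using y(3) by simp
      qed
      have "(\<Sum>v\<in>Y - {y, y'}. dist (g v) v) = (\<Sum>v\<in>Y - {y, y'}. dist (f v) v)"
        by (intro sum.cong) (auto simp: g_def Transposition.transpose_def)
      then have "len g < len f"
        unfolding split[of g] split[of f] using shorter by (simp add: g_def)
      then show False using min[OF \<open>g \<in> F\<close>] by simp
    qed
    then show ?thesis unfolding noncrossing_def by simp
  qed
  define blk where "blk a = insert a {y \<in> Y. f y = a}" for a
  \<comment> \<open>As \<open>X\<close> and \<open>Y\<close> are disjoint, each block has just one
    point of \<open>X\<close>, its center.\<close>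
  define c where "c A = (THE a. a \<in> A \<inter> X)" for A
  have c: "c (blk a) = a" if "a \<in> X" for a
    unfolding c_def using that dis by (intro the_equality) (auto simp: blk_def)
  have "partition_on (X \<union> Y) (blk ` X)"
    unfolding partition_on_def
  proof (intro conjI)
    show "\<Union> (blk ` X) = X \<union> Y" using fX by (auto simp: blk_def)
    show "disjoint (blk ` X)"
      unfolding disjoint_def using dis by (auto simp: blk_def)
    show "{} \<notin> blk ` X" by (auto simp: blk_def)
  qed
  moreover have "\<forall>A\<in>blk ` X. K13_block X Y (c A) A"
  proof
    fix A assume "A \<in> blk ` X"
    then obtain a where a: "a \<in> X" "A = blk a" by blast
    have "a \<notin> {y \<in> Y. f y = a}" using a(1) dis by blast
    then have "card A = 4" unfolding a(2) blk_def using fiber[OF a(1)] fin(2) by simp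
    then show "K13_block X Y (c A) A"
      unfolding K13_block_def using a c by (auto simp: blk_def)
  qed
  moreover have "pairwise noncrossing (star_edges (blk ` X) c)"
  proof -
    have "star_edges (blk ` X) c \<subseteq> (\<lambda>y. (f y, y)) ` Y"
      unfolding star_edges_def using c by (auto simp: blk_def)
    moreover have "pairwise noncrossing ((\<lambda>y. (f y, y)) ` Y)"
      using nc by (auto simp: pairwise_def)
    ultimately show ?thesis using pairwise_subset by blast
  qed
  ultimately show ?thesis unfolding K13_coverable_def by blast
qed

lemma K13_coverable_many_of_one_color:
  assumes "finite R" "finite B" "R \<inter> B = {}" "general_position (R \<union> B)" "k \<le> card R" "3 * k \<le> card B"
  shows "\<exists>X\<subseteq>R \<union> B. card X = 4 * k \<and> K13_coverable R B X"
proof -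
  obtain R' where R': "R' \<subseteq> R" "card R' = k" "finite R'"
    using obtain_subset_with_card_n[OF assms(5)] by metis
  obtain B' where B': "B' \<subseteq> B" "card B' = 3 * k" "finite B'"
    using obtain_subset_with_card_n[OF assms(6)] by metis
  have dis: "R' \<inter> B' = {}" using R' B' assms(3) by blast
  have "general_position (R' \<union> B')"
    using assms(4) by (rule general_position_subset) (use R' B' in blast)
  then have "K13_coverable R' B' (R' \<union> B')"
    using K13_coverable_one_center_color[OF R'(3) B'(3) dis] R' B' by simp
  then have "K13_coverable R B (R' \<union> B')"
    using K13_coverable_mono R' B' by blast
  moreover have "card (R' \<union> B') = 4 * k"
    using R' B' dis by (simp add: card_Un_disjoint)
  ultimately show ?thesis using R' B' by (intro exI[of _ "R' \<union> B'"]) auto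
qed

section \<open>Induction on the number of stars and the final bound\<close>

text \<open>If one color has \<open>3 * k\<close> points, the bounds by \<open>k\<close> provide the
  centers; otherwise both parts of a balanced split satisfy all hypotheses again.\<close>

lemma K13_coverable_weight:
  assumes "finite R" "finite B" "R \<inter> B = {}" "general_position (R \<union> B)"
    and "7 * k \<le> 2 * card R + card B" "k \<le> card R" "k \<le> card B"
  shows "\<exists>X\<subseteq>R \<union> B. card X = 4 * k \<and> K13_coverable R B X"
  using assms
proof (induction k arbitrary: R B rule: less_induct)
  case (less k)
  consider "3 * k \<le> card B" | "3 * k \<le> card R" | "card B < 3 * k" "card R < 3 * k" by linarith
  then show ?case
  proof cases
    case 1
    then show ?thesis using K13_coverable_many_of_one_color less.prems by blast
  next
    case 2
    have "\<exists>X\<subseteq>B \<union> R. card X = 4 * k \<and> K13_coverable B R X"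
      using less.prems 2 by (intro K13_coverable_many_of_one_color) (auto simp: Un_commute)
    then show ?thesis using K13_coverable_commute by (metis Un_commute)
  next
    case 3
    define i where "i = card R - 2 * k"
    \<comment> \<open>The weight bound and \<open>card B < 3 * k\<close> force
      \<open>card R > 2 * k\<close>, so the subtraction is not truncated. From
      \<open>1 \<le> i\<close> and \<open>i < k\<close> follows \<open>2 \<le> k\<close>, so
      \<open>j\<close> and \<open>j'\<close> below are smaller than \<open>k\<close>.\<close>
    have i: "card R = 2 * k + i" "1 \<le> i" "i < k" using 3 less.prems(5) unfolding i_def by linarith+
    \<comment> \<open>With \<open>3 * k - 2 * i\<close> blue points kept, the weight is exactly
      \<open>7 * k\<close>.\<close>
    have "3 * k - 2 * i \<le> card B" using i less.prems(5) by linarith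
    then obtain B' where B': "B' \<subseteq> B" "card B' = 3 * k - 2 * i" "finite B'"
      by (metis obtain_subset_with_card_n)
    have dis: "R \<inter> B' = {}" using B' less.prems(3) by blast
    have gp: "general_position (R \<union> B')"
      using less.prems(4) by (rule general_position_subset) (use B' in blast)
    define j where "j = k div 2"
    define j' where "j' = k - j"
    have j: "1 \<le> j" "j \<le> j'" "j' \<le> j + 1" "k = j + j'" unfolding j_def j'_def using i by linarith+
    have cB: "card B' + 2 * i = 3 * j + 3 * j'" "card R = 2 * j + 2 * j' + i" using B'(2) i j by linarith+
    then have "card B' + 2 * i = 3 * (j + j')" by simp
    moreover have "card R = 2 * (j + j') + i" "i < j + j'" using i j by auto
    ultimately obtain x where x: "2 * j + i \<le> x + j'" "x \<le> 3 * j" and "splits R B' x (7 * j - 2 * x)"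
      using balanced_split[OF less.prems(1) B'(3) dis gp j(1-3) i(2)] by blast
    then obtain A where A: "A \<subseteq> R \<union> B'" "card (A \<inter> R) = x" "card (A \<inter> B') = 7 * j - 2 * x"
      and hulls: "convex hull A \<inter> convex hull (R \<union> B' - A) = {}"
      unfolding splits_def by blast
    have "card (R - A) = card R - x"
      using A(2) less.prems(1) by (metis Int_commute card_Diff_subset_Int finite_Int)
    moreover have "card (B' - A) = card B' - (7 * j - 2 * x)"
      using A(3) B'(3) by (metis Int_commute card_Diff_subset_Int finite_Int)
    ultimately have right: "7 * j' \<le> 2 * card (R - A) + card (B' - A)" "j' \<le> card (R - A)" "j' \<le> card (B' - A)"
      using x i j cB by linarith+
    have left: "7 * j \<le> 2 * card (A \<inter> R) + card (A \<inter> B')" "j \<le> card (A \<inter> R)" "j \<le> card (A \<inter> B')"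
      using x i j A(2,3) by linarith+
    have "\<exists>X\<subseteq>(A \<inter> R) \<union> (A \<inter> B'). card X = 4 * j \<and> K13_coverable (A \<inter> R) (A \<inter> B') X"
    proof (rule less.IH[OF _ _ _ _ _ left])
      show "general_position (A \<inter> R \<union> A \<inter> B')"
        using gp by (rule general_position_subset) blast
    qed (use j less.prems(1) B'(3) dis in auto)
    then obtain X where X: "X \<subseteq> (A \<inter> R) \<union> (A \<inter> B')" "card X = 4 * j" "K13_coverable (A \<inter> R) (A \<inter> B') X"
      by blast
    have "\<exists>Y\<subseteq>(R - A) \<union> (B' - A). card Y = 4 * j' \<and> K13_coverable (R - A) (B' - A) Y"
    proof (rule less.IH[OF _ _ _ _ _ right])
      show "general_position ((R - A) \<union> (B' - A))"
        using gp by (rule general_position_subset) blast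
    qed (use j less.prems(1) B'(3) dis in auto)
    then obtain Y where Y: "Y \<subseteq> (R - A) \<union> (B' - A)" "card Y = 4 * j'" "K13_coverable (R - A) (B' - A) Y"
      by blast
    have sub: "X \<subseteq> A" "Y \<subseteq> R \<union> B' - A" using X(1) Y(1) by auto
    have "convex hull X \<inter> convex hull Y = {}"
      using hulls hull_mono[OF sub(1), of convex] hull_mono[OF sub(2), of convex] by blast
    moreover have "K13_coverable R B X"
      by (rule K13_coverable_mono[OF X(3)]) (use B'(1) in auto)
    moreover have "K13_coverable R B Y"
      by (rule K13_coverable_mono[OF Y(3)]) (use B'(1) in auto)
    ultimately have "K13_coverable R B (X \<union> Y)" by (rule K13_coverable_Un[rotated 2])
    moreover have "card (X \<union> Y) = 4 * k"
    proof -
      have "finite (R \<union> B')" using less.prems(1) B'(3) by simp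
      then have "finite X" "finite Y" using sub A(1) by (meson Diff_subset finite_subset order_trans)+
      then show ?thesis using sub X(2) Y(2) j(4) by (subst card_Un_disjoint) auto
    qed
    moreover have "X \<union> Y \<subseteq> R \<union> B" using sub A(1) B'(1) by auto
    ultimately show ?thesis by blast
  qed
qed

theorem theorem14:
  fixes r b :: nat and \<alpha> :: real
  assumes "r > 0" and "b > 0"
    and "\<alpha> = real b / real r"
    and "1 / 3 \<le> \<alpha>" and "\<alpha> \<le> 1"
  shows "real (C_num r b) \<ge> 4 / 7 * ((\<alpha> + 2) / (\<alpha> + 1)) * (real r + real b) - 4"
proof -
  have weight: "(\<alpha> + 2) / (\<alpha> + 1) * (real r + real b) = 2 * real r + real b"
  proof -
    have "\<alpha> + 1 = (real r + real b) / real r" "\<alpha> + 2 = (2 * real r + real b) / real r"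
      using assms(1) unfolding assms(3) by (simp_all add: field_simps)
    then show ?thesis using assms(1) by simp
  qed
  have rb: "r \<le> 3 * b" "b \<le> r"
    using assms(1,4,5) unfolding assms(3) by (simp_all add: field_simps)
  define k where "k = (2 * r + b) div 7"
  \<comment> \<open>From \<open>r \<le> 3 * b\<close> follows \<open>2 * r + b \<le> 7 * b\<close>,
    hence \<open>k \<le> b\<close>. Rounding loses at most 6 units of weight, that is
    \<open>24 / 7 < 4\<close> covered points.\<close>
  have k: "7 * k \<le> 2 * r + b" "k \<le> r" "k \<le> b" "2 * r + b \<le> 7 * k + 6"
    unfolding k_def using rb by linarith+
  have "C_num r b \<in> {C_set R B | R B. rb_set r b R B}"
    unfolding C_num_def by (rule Min_in[OF C_num_finite C_num_nonempty])
  then obtain R B where RB: "C_num r b = C_set R B" "rb_set r b R B" by blast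
  then obtain X where X: "X \<subseteq> R \<union> B" "card X = 4 * k" "K13_coverable R B X"
    using K13_coverable_weight[of R B k] k unfolding rb_set_def by blast
  have "card X \<le> C_set R B"
    unfolding C_set_def using X RB(2)
    by (intro Max_ge C_set_finite) (auto simp: rb_set_def)
  then have "4 * real k \<le> real (C_num r b)" using X(2) RB(1) by linarith
  moreover have "2 * real r + real b \<le> 7 * real k + 6" using k(4) by linarith
  ultimately have "4 / 7 * (2 * real r + real b) - 4 \<le> real (C_num r b)"
    by (simp add: field_simps)
  then show ?thesis unfolding weight[symmetric] by (simp only: mult.assoc)
qed

end
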